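(* Let $k$ be a positive integer. If $D$ is a triangle-free multipartite tournament with $\delta^+(D)\geq 2k-1$, then $D$ has $k$ vertex-disjoint cycles.
   Context: Digraphs are finite and have no loops or parallel arcs. An orientation of an undirected graph $G$ is a digraph obtained by replacing each edge $\{x,y\}$ of $G$ with exactly one of the arcs $xy$ or $yx$. A multipartite tournament is an orientation of a complete multipartite graph (with $t\ge 2$ partite sets). All cycles are directed cycles. A triangle is a directed cycle with exactly 3 arcs; a digraph is triangle-free if it has no triangles. $\delta^+(D)$ denotes the minimum out-degree of a vertex of $D$. *)

theory Defs
  imports "Graph_Theory.Graph_Theory" "HOL-Library.Disjoint_Sets"
begin

text \<open>
  Following \<^theory>\<open>Graph_Theory.Digraph\<close>, an undirected simple graph is a finite loop-free
  symmetric digraph without parallel arcs, an edge between \<open>x\<close> and \<open>y\<close> being represented by the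
  two arcs \<open>(x, y)\<close> and \<open>(y, x)\<close>. \<^const>\<open>partition_on\<close> makes all partite sets nonempty.
\<close>

definition complete_multipartite :: "'a pair_pre_digraph \<Rightarrow> 'a set set \<Rightarrow> bool" where
  "complete_multipartite G P \<longleftrightarrow>
     pair_graph G \<and> partition_on (pverts G) P \<and> card P \<ge> 2 \<and>
     parcs G = {(u, v). u \<in> pverts G \<and> v \<in> pverts G \<and> \<not> (\<exists>V\<in>P. u \<in> V \<and> v \<in> V)}"

definition orientation_of :: "('a, 'b) pre_digraph \<Rightarrow> 'a pair_pre_digraph \<Rightarrow> bool" where
  "orientation_of D G \<longleftrightarrow>
     digraph D \<and> pair_graph G \<and> verts D = pverts G \<and>
     arcs_ends D \<subseteq> parcs G \<and>
     (\<forall>(u, v)\<in>parcs G. (u \<rightarrow>\<^bsub>D\<^esub> v) \<noteq> (v \<rightarrow>\<^bsub>D\<^esub> u))"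

definition multipartite_tournament :: "('a, 'b) pre_digraph \<Rightarrow> bool" where
  "multipartite_tournament D \<longleftrightarrow> (\<exists>G P. complete_multipartite G P \<and> orientation_of D G)"

definition triangle :: "('a, 'b) pre_digraph \<Rightarrow> 'b awalk \<Rightarrow> bool" where
  "triangle D p \<longleftrightarrow> pre_digraph.cycle D p \<and> length p = 3"

definition triangle_free :: "('a, 'b) pre_digraph \<Rightarrow> bool" where
  "triangle_free D \<longleftrightarrow> \<not> (\<exists>p. triangle D p)"

text \<open>Only meaningful if \<open>D\<close> has a vertex, as every multipartite tournament does.\<close>

definition min_out_degree :: "('a, 'b) pre_digraph \<Rightarrow> nat" where
  "min_out_degree D = Min (out_degree D ` verts D)"

text \<open>A cycle is given by its list of arcs; each vertex on it is the tail of exactly one of them.\<close>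

definition cycle_verts :: "('a, 'b) pre_digraph \<Rightarrow> 'b awalk \<Rightarrow> 'a set" where
  "cycle_verts D p = tail D ` set p"

text \<open>
  Distinct members of \<open>C\<close> cannot be two arc lists of the same cycle with different starting points,
  since these have the same nonempty vertex set.
\<close>

definition has_disjoint_cycles :: "('a, 'b) pre_digraph \<Rightarrow> nat \<Rightarrow> bool" where
  "has_disjoint_cycles D k \<longleftrightarrow>
     (\<exists>C. finite C \<and> card C = k \<and> (\<forall>p\<in>C. pre_digraph.cycle D p) \<and>
          pairwise (\<lambda>p q. disjnt (cycle_verts D p) (cycle_verts D q)) C)"

end

theory Submission
  imports Defs
begin

text \<open>
  In a bipartite tournament the claim follows by deleting 4-cycles one at a time: a 4-cycle has two
  vertices in each partite set, so its deletion lowers every out-degree by at most two, and a digraph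
  without sinks still contains a cycle, the shortest of which has length four.

  With more partite sets two points need an argument. A shortest closed walk still yields a 4-cycle
  that alternates between two partite sets, because any other pattern has a chord that creates a
  triangle or a shortcut (\<open>obtain_alternating_four_cycle\<close>). A vertex \<open>x\<close> of a third partite set is
  adjacent to the whole 4-cycle, and triangle-freeness forces it to dominate all four vertices or
  none; only in the first case could the deletion cost \<open>x\<close> more than two out-neighbours. Such
  dominating vertices are avoided by working in an inclusion-minimal nonempty set \<open>S\<close> of vertices
  in which the out-degrees are still large: the vertices that are, in a suitable sense, dominated by
  all the dominating vertices form a subset of \<open>S\<close> closed under out-neighbours which contains the
  4-cycle and none of the dominating vertices (\<open>behind_closed\<close>), so by minimality there are no
  dominating vertices.
\<close>

section \<open>Triangle-free multipartite tournaments\<close>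

(* Keeps the arrow for arcs unambiguous. *)
no_notation funcset (infixr \<open>\<rightarrow>\<close> 60)

lemma dominatesE:
  assumes "u \<rightarrow>\<^bsub>D\<^esub> v"
  obtains e where "e \<in> arcs D" "tail D e = u" "head D e = v"
  using assms by (auto simp: arcs_ends_conv)

text \<open>
  In a multipartite tournament the partite sets are the classes of nonadjacency, so transitivity of
  nonadjacency encodes the partition.
\<close>

locale triangle_free_mt = digraph D for D (structure) +
  assumes dominates_asym: "u \<rightarrow> v \<Longrightarrow> \<not> v \<rightarrow> u"
    and no_triangle: "u \<rightarrow> v \<Longrightarrow> v \<rightarrow> w \<Longrightarrow> \<not> w \<rightarrow> u"
    and nonadjacent_trans:
      "u \<in> verts D \<Longrightarrow> v \<in> verts D \<Longrightarrow> w \<in> verts D \<Longrightarrow> \<not> u \<rightarrow> v \<Longrightarrow> \<not> v \<rightarrow> u \<Longrightarrow>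
       \<not> v \<rightarrow> w \<Longrightarrow> \<not> w \<rightarrow> v \<Longrightarrow> \<not> u \<rightarrow> w"
begin

definition adjacent :: "'a \<Rightarrow> 'a \<Rightarrow> bool" where
  "adjacent u v \<longleftrightarrow> u \<rightarrow> v \<or> v \<rightarrow> u"

lemma adjacent_sym: "adjacent u v \<longleftrightarrow> adjacent v u"
  by (auto simp: adjacent_def)

lemma not_adjacent_self [simp]: "\<not> adjacent u u"
  using dominates_asym[of u u] by (auto simp: adjacent_def)

lemma not_adjacent_trans:
  assumes "u \<in> verts D" "v \<in> verts D" "w \<in> verts D" "\<not> adjacent u v" "\<not> adjacent v w"
  shows "\<not> adjacent u w"
  using assms nonadjacent_trans[of u v w] nonadjacent_trans[of w v u] by (auto simp: adjacent_def)

lemma shortcut: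
  assumes "u \<rightarrow> v" "v \<rightarrow> w" "adjacent u w"
  shows "u \<rightarrow> w"
  using assms no_triangle unfolding adjacent_def by blast

text \<open>
  Otherwise the cycle has an arc from a dominated vertex to a vertex dominating \<open>u\<close>, and this arc
  closes a triangle with \<open>u\<close>.
\<close>
lemma dominates_four_cycle_or_none:
  assumes four: "a \<rightarrow> b" "b \<rightarrow> c" "c \<rightarrow> d" "d \<rightarrow> a"
    and adj: "adjacent u a" "adjacent u b" "adjacent u c" "adjacent u d"
    and "y \<in> {a, b, c, d}" "u \<rightarrow> y"
  shows "\<forall>y\<in>{a, b, c, d}. u \<rightarrow> y"
proof -
  have "u \<rightarrow> a \<Longrightarrow> u \<rightarrow> b" using four(1) adj(2) by (rule shortcut[rotated])
  moreover have "u \<rightarrow> b \<Longrightarrow> u \<rightarrow> c" using four(2) adj(3) by (rule shortcut[rotated])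
  moreover have "u \<rightarrow> c \<Longrightarrow> u \<rightarrow> d" using four(3) adj(4) by (rule shortcut[rotated])
  moreover have "u \<rightarrow> d \<Longrightarrow> u \<rightarrow> a" using four(4) adj(1) by (rule shortcut[rotated])
  moreover have "u \<rightarrow> a \<or> u \<rightarrow> b \<or> u \<rightarrow> c \<or> u \<rightarrow> d" using assms(9,10) by blast
  ultimately show ?thesis by blast
qed

section \<open>Alternating 4-cycles\<close>

text \<open>
  The first four vertices of a shortest closed walk form the 4-cycle. Those two steps apart are
  nonadjacent, hence the first and the fourth are adjacent, and the arc between them must point back
  to the first vertex since otherwise it would shorten the walk by two.
\<close>
lemma obtain_alternating_four_cycle:
  assumes "S \<subseteq> verts D" "S \<noteq> {}" and no_sink: "\<And>u. u \<in> S \<Longrightarrow> \<exists>v\<in>S. u \<rightarrow> v"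
  obtains a b c d where "{a, b, c, d} \<subseteq> S" "a \<rightarrow> b" "b \<rightarrow> c" "c \<rightarrow> d" "d \<rightarrow> a"
    "\<not> adjacent a c" "\<not> adjacent b d"
proof -
  define R where "R = arcs_ends D \<inter> S \<times> S"
  have "finite S" using assms(1) finite_verts finite_subset by blast
  then have "finite R" unfolding R_def by simp
  have "\<not> acyclic R"
  proof
    assume "acyclic R"
    then have "wf (R\<inverse>)" using \<open>finite R\<close> by (rule finite_acyclic_wf_converse[rotated])
    then obtain z where z: "z \<in> S" "\<And>y. (y, z) \<in> R\<inverse> \<Longrightarrow> y \<notin> S"
      using wfE_min'[OF _ assms(2)] by metis
    obtain v where "v \<in> S" "z \<rightarrow> v" using no_sink[OF z(1)] by blast
    then show False using z(2)[of v] z(1) by (simp add: R_def)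
  qed
  then obtain x0 n0 where "n0 > 0" "(x0, x0) \<in> R ^^ n0"
    by (auto simp: acyclic_def trancl_power)
  define closed_walk where "closed_walk n \<longleftrightarrow> n > 0 \<and> (\<exists>x. (x, x) \<in> R ^^ n)" for n
  define n where "n = (LEAST n. closed_walk n)"
  have "closed_walk n0" using \<open>n0 > 0\<close> \<open>(x0, x0) \<in> R ^^ n0\<close> by (auto simp: closed_walk_def)
  then have "closed_walk n" unfolding n_def by (rule LeastI)
  then obtain x where "n > 0" and x: "(x, x) \<in> R ^^ n" by (auto simp: closed_walk_def)
  have least: "\<not> closed_walk m" if "m < n" for m
    using that unfolding n_def by (rule not_less_Least)
  have "n \<noteq> 1" using x dominates_asym[of x x] by (auto simp: R_def)
  moreover have "n \<noteq> 2"
  proof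
    assume "n = 2"
    then obtain a where "(x, a) \<in> R" "(a, x) \<in> R" using x by (auto simp: numeral_2_eq_2)
    then show False using dominates_asym[of x a] by (simp add: R_def)
  qed
  moreover have "n \<noteq> 3"
  proof
    assume "n = 3"
    then obtain a b where "(x, a) \<in> R" "(a, b) \<in> R" "(b, x) \<in> R"
      using x by (auto simp: numeral_3_eq_3)
    then show False using no_triangle[of x a b] by (simp add: R_def)
  qed
  ultimately have "4 \<le> n" using \<open>n > 0\<close> by linarith
  then obtain m where n: "n = Suc (Suc (Suc (Suc m)))"
    using that[of "n - 4"] by linarith
  \<comment> \<open>An arc from \<open>u\<close> to \<open>w\<close> would shorten the walk, one from \<open>w\<close> to \<open>u\<close> would close a triangle.\<close>
  have two_steps: "\<not> adjacent u w"
    if "(u, v) \<in> R" "(v, w) \<in> R" "(w, u) \<in> R ^^ Suc (Suc m)" for u v w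
  proof
    assume "adjacent u w"
    then have "(u, w) \<in> R" using that(1,2) shortcut[of u v w] by (simp add: R_def)
    then have "(u, u) \<in> R ^^ Suc (Suc (Suc m))" using that(3) by (rule relpow_Suc_I2)
    then have "closed_walk (Suc (Suc (Suc m)))" by (auto simp: closed_walk_def)
    then show False using least n by auto
  qed
  obtain a where a: "(x, a) \<in> R" "(a, x) \<in> R ^^ Suc (Suc (Suc m))"
    using relpow_Suc_D2[OF x[unfolded n]] by blast
  obtain b where b: "(a, b) \<in> R" "(b, x) \<in> R ^^ Suc (Suc m)"
    using relpow_Suc_D2[OF a(2)] by blast
  obtain d where d: "(b, d) \<in> R" "(d, x) \<in> R ^^ Suc m"
    using relpow_Suc_D2[OF b(2)] by blast
  have xb: "\<not> adjacent x b" using two_steps[OF a(1) b(1,2)] .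
  have ad: "\<not> adjacent a d" using two_steps[OF b(1) d(1) relpow_Suc_I[OF d(2) a(1)]] .
  have in_S: "x \<in> S" "a \<in> S" "b \<in> S" "d \<in> S" using a(1) b(1) d(1) by (simp_all add: R_def)
  have "adjacent x d"
    using not_adjacent_trans[of a d x] ad a(1) in_S assms(1) unfolding R_def adjacent_def by blast
  moreover have "\<not> x \<rightarrow> d"
  proof
    assume "x \<rightarrow> d"
    then have "(x, d) \<in> R" using in_S by (simp add: R_def)
    then have "(x, x) \<in> R ^^ Suc (Suc m)" using d(2) by (rule relpow_Suc_I2)
    then have "closed_walk (Suc (Suc m))" by (auto simp: closed_walk_def)
    then show False using least n by auto
  qed
  ultimately have "d \<rightarrow> x" by (auto simp: adjacent_def)
  moreover have "x \<rightarrow> a" "a \<rightarrow> b" "b \<rightarrow> d" using a(1) b(1) d(1) by (simp_all add: R_def)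
  ultimately show ?thesis using that[of x a b d] in_S xb ad by blast
qed

section \<open>Vertices dominating a 4-cycle\<close>

text \<open>
  This is an invariant for following arcs that start in a 4-cycle \<open>C\<close>, where \<open>X\<close> consists of the
  vertices dominating \<open>C\<close>. A vertex of \<open>X\<close> cannot dominate the reached vertices of its own partite
  set, and for these the invariant records that they are dominated by \<open>C\<close>.
\<close>
definition behind :: "'a set \<Rightarrow> 'a set \<Rightarrow> 'a set" where
  "behind X C = {u \<in> verts D. \<forall>x\<in>X. x \<rightarrow> u \<or> \<not> adjacent x u \<and> (\<forall>c\<in>C. c \<rightarrow> u)}"

lemma behind_disjoint:
  assumes "C \<noteq> {}" and "\<And>x c. x \<in> X \<Longrightarrow> c \<in> C \<Longrightarrow> x \<rightarrow> c"
  shows "X \<inter> behind X C = {}"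
proof -
  have False if "x \<in> X" "x \<in> behind X C" for x
  proof -
    obtain c where "c \<in> C" using assms(1) by blast
    moreover have "\<forall>c\<in>C. c \<rightarrow> x"
      using that dominates_asym[of x x] by (auto simp: behind_def)
    ultimately show False using assms(2)[OF that(1), of c] dominates_asym[of x c] by blast
  qed
  then show ?thesis by blast
qed

text \<open>
  Let \<open>x \<in> X\<close>. If \<open>x\<close> is adjacent to \<open>z\<close>, then \<open>x\<close> dominates \<open>z\<close> by triangle-freeness, applied along
  \<open>x \<rightarrow> u \<rightarrow> z\<close> or, when \<open>u\<close> is in the partite set of \<open>x\<close>, along \<open>y \<rightarrow> u \<rightarrow> z\<close> and \<open>x \<rightarrow> y \<rightarrow> z\<close> for a
  vertex \<open>y\<close> of the cycle. If \<open>z\<close> is in the partite set of \<open>x\<close>, it is adjacent to the whole cycle;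
  were it not dominated by all of the cycle, it would dominate it and so belong to \<open>X\<close>, but then the
  arc from \<open>u\<close> to \<open>z\<close> would contradict that \<open>u\<close> lies behind \<open>z\<close>.
\<close>
lemma behind_closed:
  assumes four: "a \<rightarrow> b" "b \<rightarrow> c" "c \<rightarrow> d" "d \<rightarrow> a"
    and X: "X = {x \<in> S. \<forall>y\<in>{a, b, c, d}. x \<rightarrow> y}"
    and u: "u \<in> behind X {a, b, c, d}" and uz: "u \<rightarrow> z" and "z \<in> S"
  shows "z \<in> behind X {a, b, c, d}"
proof -
  have verts: "a \<in> verts D" "b \<in> verts D" "c \<in> verts D" "d \<in> verts D" "u \<in> verts D" "z \<in> verts D"
    using four uz by (auto dest: adj_in_verts)
  have z_notin: "z \<notin> X"
    using u uz dominates_asym unfolding behind_def adjacent_def by blast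
  have "x \<rightarrow> z \<or> \<not> adjacent x z \<and> (\<forall>y\<in>{a, b, c, d}. y \<rightarrow> z)" if "x \<in> X" for x
  proof (cases "adjacent x z")
    case True
    have dom: "x \<rightarrow> a" "x \<rightarrow> b" using \<open>x \<in> X\<close> X by simp_all
    consider "x \<rightarrow> u" | "\<forall>y\<in>{a, b, c, d}. y \<rightarrow> u"
      using u \<open>x \<in> X\<close> unfolding behind_def by blast
    then have "x \<rightarrow> z"
    proof cases
      case 1
      then show ?thesis using uz True by (rule shortcut)
    next
      case 2
      \<comment> \<open>As \<open>a\<close> and \<open>b\<close> lie in different partite sets, one of them is adjacent to \<open>z\<close>.\<close>
      have "adjacent a z \<or> adjacent b z"
        using not_adjacent_trans[of a z b] verts four by (auto simp: adjacent_def)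
      then obtain y where y: "y = a \<or> y = b" "adjacent y z" by blast
      then have "y \<rightarrow> u" "x \<rightarrow> y" using 2 dom by auto
      then show ?thesis using shortcut[OF \<open>y \<rightarrow> u\<close> uz y(2)] shortcut[OF \<open>x \<rightarrow> y\<close> _ True] by simp
    qed
    then show ?thesis by blast
  next
    case False
    have "x \<rightarrow> a" using \<open>x \<in> X\<close> X by simp
    then have "x \<in> verts D" by (rule adj_in_verts)
    have adj: "adjacent z y" if "y \<in> {a, b, c, d}" for y
    proof -
      have "x \<rightarrow> y" using that \<open>x \<in> X\<close> X by blast
      moreover from this have "y \<in> verts D" by (rule adj_in_verts)
      ultimately show ?thesis
        using not_adjacent_trans[OF \<open>x \<in> verts D\<close> verts(6), of y] False
        unfolding adjacent_def by blast
    qed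
    have "\<forall>y\<in>{a, b, c, d}. y \<rightarrow> z"
    proof (rule ccontr)
      assume "\<not> ?thesis"
      then obtain y where y: "y \<in> {a, b, c, d}" "\<not> y \<rightarrow> z" by blast
      then have "z \<rightarrow> y" using adj[OF y(1)] by (simp add: adjacent_def)
      then have "\<forall>y\<in>{a, b, c, d}. z \<rightarrow> y"
        using dominates_four_cycle_or_none[OF four, of z y] adj y(1) by blast
      then show False using z_notin \<open>z \<in> S\<close> unfolding X by simp
    qed
    then show ?thesis using False by blast
  qed
  then show ?thesis using verts(6) unfolding behind_def by blast
qed

text \<open>
  A vertex adjacent to both partite sets of the 4-cycle dominates none of its vertices, as it does
  not dominate all of them; any other vertex can dominate only the two vertices in one partite set.
\<close>
lemma four_cycle_out_neighbours:
  assumes four: "a \<rightarrow> b" "b \<rightarrow> c" "c \<rightarrow> d" "d \<rightarrow> a"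
    and alternating: "\<not> adjacent a c" "\<not> adjacent b d"
    and "u \<in> verts D" and not_all: "\<not> (\<forall>y\<in>{a, b, c, d}. u \<rightarrow> y)"
  shows "card {v \<in> {a, b, c, d}. u \<rightarrow> v} \<le> 2"
proof -
  have verts: "a \<in> verts D" "b \<in> verts D" "c \<in> verts D" "d \<in> verts D"
    using four by (auto dest: adj_in_verts)
  have "{v \<in> {a, b, c, d}. u \<rightarrow> v} \<subseteq> {a, c} \<or> {v \<in> {a, b, c, d}. u \<rightarrow> v} \<subseteq> {b, d}"
  proof (cases "adjacent u a \<and> adjacent u b")
    case True
    then have "adjacent u c" "adjacent u d"
      using not_adjacent_trans[of u c a] not_adjacent_trans[of u d b] verts alternating
        \<open>u \<in> verts D\<close> adjacent_sym by blast+
    then have "\<not> (\<exists>y\<in>{a, b, c, d}. u \<rightarrow> y)"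
      using dominates_four_cycle_or_none[OF four] True not_all by blast
    then show ?thesis by blast
  next
    case False
    then consider "\<not> adjacent u a" "\<not> adjacent u c" | "\<not> adjacent u b" "\<not> adjacent u d"
      using not_adjacent_trans[of u a c] not_adjacent_trans[of u b d] verts alternating
        \<open>u \<in> verts D\<close> by blast
    then show ?thesis by cases (auto simp: adjacent_def)
  qed
  moreover have "card {a, c} \<le> 2" "card {b, d} \<le> 2" by (auto intro: card_insert_le_m1)
  ultimately show ?thesis by (meson card_mono finite.emptyI finite.insertI order_trans)
qed

section \<open>Deleting 4-cycles one at a time\<close>

lemma four_cycle_is_cycle:
  assumes "a \<rightarrow> b" "b \<rightarrow> c" "c \<rightarrow> d" "d \<rightarrow> a" "a \<noteq> c" "b \<noteq> d"
  obtains p where "cycle p" "cycle_verts D p = {a, b, c, d}"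
proof -
  obtain e f g h where arcs: "e \<in> arcs D" "f \<in> arcs D" "g \<in> arcs D" "h \<in> arcs D"
    and ends: "tail D e = a" "head D e = b" "tail D f = b" "head D f = c"
      "tail D g = c" "head D g = d" "tail D h = d" "head D h = a"
    using assms(1-4) by (metis dominatesE)
  have "a \<in> verts D" using assms(1) by (auto dest: adj_in_verts)
  then have "awalk a [e, f, g, h] a" using arcs ends by (simp add: awalk_simps)
  moreover have "distinct (tl (awalk_verts a [e, f, g, h]))"
    using ends assms dominates_asym[of b b] dominates_asym[of c c] dominates_asym[of d d]
      dominates_asym[of a a] by auto
  ultimately have "cycle [e, f, g, h]" unfolding cycle_def by blast
  then show ?thesis using that ends by (simp add: cycle_verts_def)
qed

definition out_degree_ge :: "nat \<Rightarrow> 'a set \<Rightarrow> bool" where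
  "out_degree_ge n S \<longleftrightarrow> S \<noteq> {} \<and> S \<subseteq> verts D \<and> (\<forall>u\<in>S. n \<le> card {v \<in> S. u \<rightarrow> v})"

text \<open>
  \<open>T\<close> is an inclusion-minimal subset of \<open>S\<close> with the degree property. The part of \<open>T\<close> lying behind
  the vertices that dominate the 4-cycle keeps all its out-neighbours in \<open>T\<close>, so it is all of \<open>T\<close>,
  and no vertex of \<open>T\<close> dominates the whole 4-cycle.
\<close>
lemma obtain_four_cycle_with_small_loss:
  assumes deg: "out_degree_ge n S" and "n > 0"
  obtains T a b c d where "T \<subseteq> S" "out_degree_ge n T" "{a, b, c, d} \<subseteq> T"
    "a \<rightarrow> b" "b \<rightarrow> c" "c \<rightarrow> d" "d \<rightarrow> a" "a \<noteq> c" "b \<noteq> d"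
    "\<And>u. u \<in> T \<Longrightarrow> card {v \<in> {a, b, c, d}. u \<rightarrow> v} \<le> 2"
proof -
  have "finite S" using deg finite_subset[OF _ finite_verts] unfolding out_degree_ge_def by blast
  then have "finite {T. T \<subseteq> S \<and> out_degree_ge n T}" by simp
  moreover have "S \<in> {T. T \<subseteq> S \<and> out_degree_ge n T}" using deg by simp
  ultimately obtain T where T: "T \<subseteq> S" "out_degree_ge n T"
    and minimal: "\<And>T'. T' \<subseteq> S \<Longrightarrow> out_degree_ge n T' \<Longrightarrow> T' \<subseteq> T \<Longrightarrow> T' = T"
    using finite_has_minimal2[of "{T. T \<subseteq> S \<and> out_degree_ge n T}" S] by auto metis
  have T': "T \<noteq> {}" "T \<subseteq> verts D" and degT: "\<And>u. u \<in> T \<Longrightarrow> n \<le> card {v \<in> T. u \<rightarrow> v}"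
    using T(2) by (auto simp: out_degree_ge_def)
  have "\<exists>v\<in>T. u \<rightarrow> v" if "u \<in> T" for u
  proof -
    have "card {v \<in> T. u \<rightarrow> v} \<noteq> 0" using degT[OF that] \<open>n > 0\<close> by linarith
    then show ?thesis by (metis (no_types, lifting) card.empty empty_Collect_eq)
  qed
  then obtain a b c d where four: "a \<rightarrow> b" "b \<rightarrow> c" "c \<rightarrow> d" "d \<rightarrow> a"
    and in_T: "{a, b, c, d} \<subseteq> T" and alternating: "\<not> adjacent a c" "\<not> adjacent b d"
    using obtain_alternating_four_cycle[OF T'(2,1)] by metis
  define X where "X = {x \<in> T. \<forall>y\<in>{a, b, c, d}. x \<rightarrow> y}"
  define Z where "Z = behind X {a, b, c, d} \<inter> T"
  have "a \<in> Z" using in_T T'(2) by (auto simp: Z_def behind_def X_def)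
  have "{v \<in> Z. u \<rightarrow> v} = {v \<in> T. u \<rightarrow> v}" if "u \<in> Z" for u
    using behind_closed[OF four X_def] that by (auto simp: Z_def)
  then have "out_degree_ge n Z"
    using \<open>a \<in> Z\<close> degT T' unfolding out_degree_ge_def by (auto simp: Z_def)
  moreover have "Z \<subseteq> T" by (simp add: Z_def)
  ultimately have "Z = T" using minimal[of Z] T(1) by blast
  moreover have "X \<inter> behind X {a, b, c, d} = {}"
    by (rule behind_disjoint) (auto simp: X_def)
  ultimately have "X = {}" unfolding Z_def X_def by blast
  have "card {v \<in> {a, b, c, d}. u \<rightarrow> v} \<le> 2" if "u \<in> T" for u
  proof (rule four_cycle_out_neighbours[OF four alternating])
    show "u \<in> verts D" using that T'(2) by blast
    show "\<not> (\<forall>y\<in>{a, b, c, d}. u \<rightarrow> y)" using that \<open>X = {}\<close> unfolding X_def by blast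
  qed
  moreover have "a \<noteq> c" "b \<noteq> d"
    using four dominates_asym by blast+
  ultimately show ?thesis using that[OF T in_T four] by blast
qed

text \<open>
  Once a 4-cycle with small loss is deleted, the induction hypothesis applies to what remains: every
  out-degree has dropped by at most two.
\<close>
lemma disjoint_cycles_within:
  assumes "out_degree_ge (2 * k - 1) S"
  shows "\<exists>C. finite C \<and> card C = k \<and> (\<forall>p\<in>C. cycle p \<and> cycle_verts D p \<subseteq> S) \<and>
           pairwise (\<lambda>p q. disjnt (cycle_verts D p) (cycle_verts D q)) C"
  using assms
proof (induction k arbitrary: S)
  case 0
  show ?case by (intro exI[of _ "{}"]) auto
next
  case (Suc k)
  obtain T a b c d where T: "T \<subseteq> S" "out_degree_ge (2 * Suc k - 1) T" and in_T: "{a, b, c, d} \<subseteq> T"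
    and four: "a \<rightarrow> b" "b \<rightarrow> c" "c \<rightarrow> d" "d \<rightarrow> a" "a \<noteq> c" "b \<noteq> d"
    and loss: "\<And>u. u \<in> T \<Longrightarrow> card {v \<in> {a, b, c, d}. u \<rightarrow> v} \<le> 2"
    by (rule obtain_four_cycle_with_small_loss[OF Suc.prems]) (simp, blast)
  obtain p where p: "cycle p" "cycle_verts D p = {a, b, c, d}"
    using four_cycle_is_cycle[OF four] .
  let ?T = "T - {a, b, c, d}"
  have "finite T" using T(2) finite_subset[OF _ finite_verts] unfolding out_degree_ge_def by blast
  have deg: "2 * k - 1 \<le> card {v \<in> ?T. u \<rightarrow> v}" if "u \<in> T" for u
  proof -
    have "{v \<in> T. u \<rightarrow> v} = {v \<in> ?T. u \<rightarrow> v} \<union> {v \<in> {a, b, c, d}. u \<rightarrow> v}" using in_T by blast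
    then have "card {v \<in> T. u \<rightarrow> v} \<le> card {v \<in> ?T. u \<rightarrow> v} + card {v \<in> {a, b, c, d}. u \<rightarrow> v}"
      by (simp only: card_Un_le)
    moreover have "2 * Suc k - 1 \<le> card {v \<in> T. u \<rightarrow> v}"
      using T(2) that by (auto simp: out_degree_ge_def)
    ultimately show ?thesis using loss[OF that] by presburger
  qed
  have "\<exists>C. finite C \<and> card C = k \<and> (\<forall>q\<in>C. cycle q \<and> cycle_verts D q \<subseteq> ?T) \<and>
          pairwise (\<lambda>p q. disjnt (cycle_verts D p) (cycle_verts D q)) C"
  proof (cases "k = 0")
    case True
    then show ?thesis by (intro exI[of _ "{}"]) auto
  next
    case False
    then have "card {v \<in> ?T. a \<rightarrow> v} \<noteq> 0" using deg[of a] in_T by auto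
    then have "?T \<noteq> {}" by (metis (no_types, lifting) Collect_empty_eq card.empty empty_iff)
    then have "out_degree_ge (2 * k - 1) ?T"
      using deg T(2) by (auto simp: out_degree_ge_def)
    then show ?thesis by (rule Suc.IH)
  qed
  then obtain C where C: "finite C" "card C = k"
      "\<And>q. q \<in> C \<Longrightarrow> cycle q \<and> cycle_verts D q \<subseteq> ?T"
      "pairwise (\<lambda>p q. disjnt (cycle_verts D p) (cycle_verts D q)) C"
    by blast
  have disj: "disjnt (cycle_verts D p) (cycle_verts D q)" if "q \<in> C" for q
    using C(3)[OF that] p(2) by (auto simp: disjnt_def)
  have "p \<notin> C" using C(3)[of p] p(2) by auto
  show ?case
  proof (intro exI[of _ "insert p C"] conjI ballI)
    show "finite (insert p C)" "card (insert p C) = Suc k" using C(1,2) \<open>p \<notin> C\<close> by auto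
    show "pairwise (\<lambda>p q. disjnt (cycle_verts D p) (cycle_verts D q)) (insert p C)"
      using C(4) disj by (auto simp: pairwise_insert disjnt_sym)
  next
    fix q assume "q \<in> insert p C"
    then show "cycle q" "cycle_verts D q \<subseteq> S" using C(3)[of q] p in_T T(1) by auto
  qed
qed

end

section \<open>Multipartite tournaments given by partite sets\<close>

lemma (in nomulti_digraph) out_degree_eq_card_out_neighbours:
  "out_degree G u = card {v \<in> verts G. u \<rightarrow> v}"
proof -
  have "head G ` out_arcs G u = {v \<in> verts G. u \<rightarrow> v}"
    by (auto simp: arcs_ends_conv out_arcs_def)
  moreover have "inj_on (head G) (out_arcs G u)"
    by (auto intro!: inj_onI no_multi_arcs simp: arc_to_ends_def)
  ultimately show ?thesis unfolding out_degree_def by (metis card_image)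
qed

lemma triangle_free_mtI:
  assumes "multipartite_tournament D" "triangle_free D"
  shows "triangle_free_mt D"
proof -
  obtain G P where G: "complete_multipartite G P" and D: "orientation_of D G"
    using assms(1) by (auto simp: multipartite_tournament_def)
  interpret digraph D using D by (simp add: orientation_of_def)
  have part: "partition_on (verts D) P" and sub: "arcs_ends D \<subseteq> parcs G"
    and edge: "(u, v) \<in> parcs G \<longleftrightarrow>
      u \<in> verts D \<and> v \<in> verts D \<and> \<not> (\<exists>V\<in>P. u \<in> V \<and> v \<in> V)"
    and one: "(u, v) \<in> parcs G \<Longrightarrow> (u \<rightarrow>\<^bsub>D\<^esub> v) \<noteq> (v \<rightarrow>\<^bsub>D\<^esub> u)" for u v
    using G D by (auto simp: complete_multipartite_def orientation_of_def)
  have asym: "\<not> v \<rightarrow>\<^bsub>D\<^esub> u" if "u \<rightarrow>\<^bsub>D\<^esub> v" for u v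
    using one[of u v] sub that by auto
  show ?thesis
  proof unfold_locales
    fix u v w
    assume uvw: "u \<rightarrow>\<^bsub>D\<^esub> v" "v \<rightarrow>\<^bsub>D\<^esub> w"
    show "\<not> w \<rightarrow>\<^bsub>D\<^esub> u"
    proof
      assume "w \<rightarrow>\<^bsub>D\<^esub> u"
      with uvw obtain e f g where arcs: "e \<in> arcs D" "f \<in> arcs D" "g \<in> arcs D"
        and ends: "tail D e = u" "head D e = v" "tail D f = v" "head D f = w"
          "tail D g = w" "head D g = u"
        by (metis dominatesE)
      have "u \<in> verts D" using uvw by (auto dest: adj_in_verts)
      then have "awalk u [e, f, g] u" using arcs ends by (simp add: awalk_simps)
      moreover have "distinct (tl (awalk_verts u [e, f, g]))"
        using ends uvw \<open>w \<rightarrow>\<^bsub>D\<^esub> u\<close> asym[of u u] asym[of v v] asym[of w w] by auto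
      ultimately have "triangle D [e, f, g]" unfolding triangle_def cycle_def by auto
      then show False using assms(2) by (auto simp: triangle_free_def)
    qed
  next
    fix u v w
    assume verts: "u \<in> verts D" "v \<in> verts D" "w \<in> verts D"
      and "\<not> u \<rightarrow>\<^bsub>D\<^esub> v" "\<not> v \<rightarrow>\<^bsub>D\<^esub> u" "\<not> v \<rightarrow>\<^bsub>D\<^esub> w" "\<not> w \<rightarrow>\<^bsub>D\<^esub> v"
    then have "(u, v) \<notin> parcs G" "(v, w) \<notin> parcs G" using one by blast+
    then have "\<exists>V\<in>P. u \<in> V \<and> v \<in> V" "\<exists>W\<in>P. v \<in> W \<and> w \<in> W"
      using edge[of u v] edge[of v w] verts by simp_all
    then obtain V W where VW: "V \<in> P" "u \<in> V" "v \<in> V" "W \<in> P" "v \<in> W" "w \<in> W" by blast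
    then have "V = W" using disjointD[OF partition_onD2[OF part], of V W] by blast
    then have "(u, w) \<notin> parcs G" using edge[of u w] VW by blast
    then show "\<not> u \<rightarrow>\<^bsub>D\<^esub> w" using sub by blast
  qed (use asym in blast)
qed

theorem lemma2p2:
  fixes D :: "('a, 'b) pre_digraph" and k :: nat
  assumes "k > 0"
    and "multipartite_tournament D"
    and "triangle_free D"
    and "min_out_degree D \<ge> 2 * k - 1"
  shows "has_disjoint_cycles D k"
proof -
  interpret triangle_free_mt D using assms(2,3) by (rule triangle_free_mtI)
  obtain G P where "partition_on (verts D) P" "card P \<ge> 2"
    using assms(2)
    by (auto simp: multipartite_tournament_def complete_multipartite_def orientation_of_def)
  then have "P \<noteq> {}" "verts D = \<Union>P" "{} \<notin> P"
    by (auto dest: partition_onD1 partition_onD3)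
  then have "verts D \<noteq> {}" by (metis Union_empty_conv ex_in_conv)
  moreover have "2 * k - 1 \<le> card {v \<in> verts D. u \<rightarrow>\<^bsub>D\<^esub> v}" if "u \<in> verts D" for u
  proof -
    have "min_out_degree D \<le> out_degree D u" using that by (simp add: min_out_degree_def)
    then show ?thesis using assms(4) by (simp add: out_degree_eq_card_out_neighbours)
  qed
  ultimately have "out_degree_ge (2 * k - 1) (verts D)" by (simp add: out_degree_ge_def)
  from disjoint_cycles_within[OF this] show ?thesis
    unfolding has_disjoint_cycles_def by blast
qed

end
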